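(* Let $d,T\ge 1$ be integers, $D,G,\lambda>0$, $\mathcal{D}=\{\mathbf{w}\in\mathbb{R}^d:\|\mathbf{w}\|\le D/2\}$. Let $f_1,\dots,f_T:\mathcal{D}\to\mathbb{R}$ be $\lambda$-strongly convex loss functions with $\max_{\mathbf{w}\in\mathcal{D}}\|\nabla f_t(\mathbf{w})\|\le G$ for all $t\in\{1,\dots,T\}$. Let $S\ge 0$ be a switching cost budget, with either $S\in[\frac{2G}{\lambda}\log(T+1),DT]$ or $S\in[0,\frac{2G}{\lambda}\log(T+1))$. Let $\mathbf{w}_1\in\mathcal{D}$ and $$\mathbf{w}_{t+1}=\Pi_{\mathcal{D}}\left[\mathbf{w}_t-\eta_t\nabla f_t(\mathbf{w}_t)\right],\qquad \eta_t=\frac{1}{\lambda(t+c)},$$ with $$c=\begin{cases}0, & S\in[\frac{2G}{\lambda}\log(T+1),DT],\\[4pt] \dfrac{T}{\exp(\frac{\lambda}{2G}S)-1}-1, & S\in[0,\frac{2G}{\lambda}\log(T+1)),\end{cases}$$ where for $S=0$ one reads $c=+\infty$, i.e. $\eta_t=0$. Then $$\sum_{t=2}^T\|\mathbf{w}_t-\mathbf{w}_{t-1}\|\le S,$$ and the regret $R=\sum_{t=1}^T f_t(\mathbf{w}_t)-\min_{\mathbf{w}\in\mathcal{D}}\sum_{t=1}^T f_t(\mathbf{w})$ satisfies $$R\le \lambda D^2+\frac{2G^2}{\lambda}\log(T+1)\qquad\text{for } S\in\left[\tfrac{2G}{\lambda}\log(T+1),DT\right],$$ and $$R\le \min\left\{\frac{\lambda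 TD^2}{\exp(\frac{\lambda}{2G}S)-1}+GS,\ DGT\right\}\qquad\text{for } S\in\left[0,\tfrac{2G}{\lambda}\log(T+1)\right),$$ where for $S=0$ the first term in the minimum is read as $+\infty$.
   Context: $\|\cdot\|$ is the Euclidean norm and $\log$ is the natural logarithm. $\Pi_{\mathcal{D}}[\mathbf{p}]=\operatorname{argmin}_{\mathbf{w}\in\mathcal{D}}(\mathbf{w}-\mathbf{p})^\top(\mathbf{w}-\mathbf{p})$ is the Euclidean projection onto $\mathcal{D}$. A function $f:\mathcal{D}\to\mathbb{R}$ (with gradient $\nabla f$) is $\lambda$-strongly convex if $f(\mathbf{w}_1)\ge f(\mathbf{w}_2)+\nabla f(\mathbf{w}_2)^\top(\mathbf{w}_1-\mathbf{w}_2)+\frac{\lambda}{2}\|\mathbf{w}_1-\mathbf{w}_2\|^2$ for all $\mathbf{w}_1,\mathbf{w}_2\in\mathcal{D}$. Protocol: in each round $t$ the player selects $\mathbf{w}_t\in\mathcal{D}$, after which $f_t$ is revealed (possibly chosen depending on $\mathbf{w}_1,\dots,\mathbf{w}_t$). *)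

theory Defs
  imports "HOL-Analysis.Analysis"
begin

text \<open>The derivative is taken within X, so that it makes sense at boundary points of a closed
  domain and depends only on the values of f on X. On a ball of positive radius
  it determines the gradient uniquely.\<close>

definition has_gradient_on ::
  "('a::real_inner \<Rightarrow> real) \<Rightarrow> ('a \<Rightarrow> 'a) \<Rightarrow> 'a set \<Rightarrow> bool" where
  "has_gradient_on f g X \<longleftrightarrow>
     (\<forall>x\<in>X. (f has_derivative (\<lambda>h. g x \<bullet> h)) (at x within X))"

definition strongly_convex_on ::
  "real \<Rightarrow> ('a::real_inner \<Rightarrow> real) \<Rightarrow> ('a \<Rightarrow> 'a) \<Rightarrow> 'a set \<Rightarrow> bool" where
  "strongly_convex_on lam f g X \<longleftrightarrow>
     has_gradient_on f g X \<and>
     (\<forall>x\<in>X. \<forall>y\<in>X. f x \<ge> f y + g y \<bullet> (x - y) + lam / 2 * (norm (x - y))\<^sup>2)"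

definition budget_threshold :: "real \<Rightarrow> real \<Rightarrow> nat \<Rightarrow> real" where
  "budget_threshold G lam T = 2 * G / lam * ln (real T + 1)"

text \<open>The value at S = 0 is an artefact of division by zero (the intended one is
  infinity); the step size does not use it.\<close>

definition step_offset :: "real \<Rightarrow> real \<Rightarrow> nat \<Rightarrow> real \<Rightarrow> real" where
  "step_offset G lam T S =
     (if S \<ge> budget_threshold G lam T then 0
      else real T / (exp (lam / (2 * G) * S) - 1) - 1)"

definition step_size :: "real \<Rightarrow> real \<Rightarrow> nat \<Rightarrow> real \<Rightarrow> nat \<Rightarrow> real" where
  "step_size G lam T S t =
     (if S = 0 then 0 else 1 / (lam * (real t + step_offset G lam T S)))"

definition switching_cost :: "nat \<Rightarrow> (nat \<Rightarrow> 'a::real_normed_vector) \<Rightarrow> real" where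
  "switching_cost T w = (\<Sum>t=2..T. norm (w t - w (t - 1)))"

definition regret :: "nat \<Rightarrow> 'a set \<Rightarrow> (nat \<Rightarrow> 'a \<Rightarrow> real) \<Rightarrow> (nat \<Rightarrow> 'a) \<Rightarrow> real" where
  "regret T X f w = (\<Sum>t=1..T. f t (w t)) - (INF x\<in>X. \<Sum>t=1..T. f t x)"

text \<open>For differentiable losses on a nonempty compact domain, the infimum in the regret
  is an attained minimum.\<close>

lemma INF_loss_attained:
  fixes f :: "nat \<Rightarrow> 'a::real_inner \<Rightarrow> real"
  assumes "compact X" "X \<noteq> {}"
    and "\<And>t. t \<in> {1..T} \<Longrightarrow> has_gradient_on (f t) (g t) X"
  obtains u where "u \<in> X" "(INF x\<in>X. \<Sum>t=1..T. f t x) = (\<Sum>t=1..T. f t u)"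
    "\<And>x. x \<in> X \<Longrightarrow> (\<Sum>t=1..T. f t u) \<le> (\<Sum>t=1..T. f t x)"
proof -
  have "continuous_on X (f t)" if "t \<in> {1..T}" for t
    using assms(3)[OF that] unfolding has_gradient_on_def
    by (meson has_derivative_continuous_on)
  then have "continuous_on X (\<lambda>x. \<Sum>t=1..T. f t x)"
    by (intro continuous_on_sum) auto
  then obtain u where u: "u \<in> X" "\<forall>x\<in>X. (\<Sum>t=1..T. f t u) \<le> (\<Sum>t=1..T. f t x)"
    using continuous_attains_inf assms(1,2) by metis
  moreover have "(INF x\<in>X. \<Sum>t=1..T. f t x) = (\<Sum>t=1..T. f t u)"
    by (rule cInf_eq_minimum) (use u in auto)
  ultimately show thesis using that by blast
qed

end

theory Submission
  imports Defs
begin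

text \<open>A projected gradient step moves by at most its step size times G, so the switching cost is
  at most G / lam times the sum of 1 / (t + c). This sum is at most 2 ln ((T + 1 + c) / (1 + c)), and
  c is chosen so that this equals lam S / G whenever S lies below the threshold. For the regret,
  strong convexity turns the usual descent inequality for the squared distances to the comparator
  into a telescoping sum, which costs lam c D^2 / 2 plus G^2 / (2 lam) times the same sum.\<close>

text \<open>The terms telescope through \<open>1 / x <= 2 * (ln (x + 1) - ln x)\<close> for
  \<open>x >= 1\<close>. Comparing each term with the interval to its right keeps the denominator at
  \<open>1 + c\<close>, so the bound stays finite at \<open>c = 0\<close>; the price is the factor
  2.\<close>

lemma sum_inverse_shift_le_ln:
  fixes c :: real
  assumes "c \<ge> 0"
  shows "(\<Sum>t=1..n. 1 / (real t + c)) \<le> 2 * ln ((real n + 1 + c) / (1 + c))"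
proof (induction n)
  case 0
  then show ?case using assms by simp
next
  case (Suc n)
  define x where "x = real (Suc n) + c"
  have x: "x \<ge> 1" using assms by (simp add: x_def)
  have "1 / x \<le> 2 * ln (1 + 1 / x)"
  proof -
    \<comment> \<open>The factor 2 arises here: \<open>x + 1 <= 2 * x\<close> because
      \<open>x >= 1\<close>.\<close>
    have "1 / (2 * x) \<le> 1 / (x + 1)"
      using x by (simp add: frac_le)
    also have "\<dots> = 1 - 1 / (1 + 1 / x)"
      using x by (simp add: field_simps)
    also have "\<dots> \<le> ln (1 + 1 / x)"
    proof -
      have "1 + 1 / x > 0" using x by (simp add: add_pos_pos)
      then show ?thesis
        using ln_le_minus_one[of "1 / (1 + 1 / x)"] by (simp add: ln_div)
    qed
    finally show ?thesis using x by (simp add: field_simps)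
  qed
  moreover have "1 + 1 / x = (x + 1) / x"
    using x by (simp add: field_simps)
  ultimately have "1 / x \<le> 2 * (ln (x + 1) - ln x)"
    using x by (simp add: ln_div)
  with Suc assms show ?case
    by (simp add: x_def ln_div add_ac)
qed

text \<open>Projection is nonexpansive and fixes \<open>x\<close>, so the projected step is no
  longer than the unprojected one.\<close>

lemma norm_closest_point_step_le:
  fixes X :: "'a::euclidean_space set"
  assumes "convex X" "closed X" "x \<in> X" "e \<ge> 0" "norm y \<le> G"
  shows "norm (closest_point X (x - e *\<^sub>R y) - x) \<le> G * e"
proof -
  have "norm (closest_point X (x - e *\<^sub>R y) - x) \<le> norm ((x - e *\<^sub>R y) - x)"
    using closest_point_lipschitz[of X "x - e *\<^sub>R y" x] closest_point_self[of x X] assms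
    by (auto simp: dist_norm)
  also have "\<dots> = e * norm y" using assms by simp
  also have "\<dots> \<le> G * e" using mult_left_mono[OF assms(5,4)] by (simp add: mult.commute)
  finally show ?thesis .
qed

lemma switching_cost_projected_gradient_le:
  fixes X :: "'a::euclidean_space set"
  assumes "convex X" "closed X" "G \<ge> 0"
    and "\<And>t. t \<in> {1..T} \<Longrightarrow> w t \<in> X"
    and "\<And>t. t \<in> {1..T} \<Longrightarrow> norm (g t (w t)) \<le> G"
    and "\<And>t. t \<in> {1..T} \<Longrightarrow> e t \<ge> 0"
    and "\<And>t. t \<in> {1..<T} \<Longrightarrow> w (t + 1) = closest_point X (w t - e t *\<^sub>R g t (w t))"
  shows "switching_cost T w \<le> G * (\<Sum>t=1..T. e t)"
proof -
  have "switching_cost T w = (\<Sum>t\<in>{1..<T}. norm (w (t + 1) - w t))"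
    unfolding switching_cost_def
    by (rule sum.reindex_bij_witness[of _ Suc "\<lambda>t. t - 1"]) auto
  also have "\<dots> \<le> (\<Sum>t\<in>{1..<T}. G * e t)"
  proof (rule sum_mono)
    fix t assume "t \<in> {1..<T}"
    then show "norm (w (t + 1) - w t) \<le> G * e t"
      using norm_closest_point_step_le[OF assms(1,2) assms(4,6,5)] assms(7) by auto
  qed
  \<comment> \<open>Only the steps before round T move the iterate. The nonnegative term for T is
    added so that the sum is the one in the regret bound.\<close>
  also have "\<dots> \<le> (\<Sum>t=1..T. G * e t)"
    using assms(3,6) by (intro sum_mono2) auto
  finally show ?thesis by (simp add: sum_distrib_left)
qed

text \<open>The form is made for telescoping: with \<open>s = t + c\<close>, the weight
  \<open>s\<close> of the new distance in round t is the weight \<open>s - 1\<close> of the old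
  distance in round t + 1.\<close>

lemma projected_gradient_step_regret:
  fixes X :: "'a::euclidean_space set"
  assumes "convex X" "closed X" "lam > 0" "s > 0"
    and "strongly_convex_on lam f g X" "x \<in> X" "u \<in> X" "norm (g x) \<le> G"
  shows "f x - f u \<le> lam / 2 * ((s - 1) * (norm (x - u))\<^sup>2
      - s * (norm (closest_point X (x - (1 / (lam * s)) *\<^sub>R g x) - u))\<^sup>2) + G\<^sup>2 / (2 * lam) * (1 / s)"
proof -
  define e where "e = 1 / (lam * s)"
  define v where "v = closest_point X (x - e *\<^sub>R g x)"
  have e: "e > 0" using assms by (simp add: e_def)
  have "norm (v - u) \<le> norm ((x - u) - e *\<^sub>R g x)"
    using closest_point_lipschitz[of X "x - e *\<^sub>R g x" u] closest_point_self[of u X] assms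
    by (auto simp: dist_norm v_def algebra_simps)
  then have "(norm (v - u))\<^sup>2 \<le> (norm ((x - u) - e *\<^sub>R g x))\<^sup>2"
    by (intro power_mono) auto
  also have "\<dots> = (norm (x - u))\<^sup>2 - 2 * e * (g x \<bullet> (x - u)) + e\<^sup>2 * (norm (g x))\<^sup>2"
    unfolding power2_norm_eq_inner
    by (simp add: inner_diff_left inner_diff_right inner_commute power2_eq_square algebra_simps)
  also have "e\<^sup>2 * (norm (g x))\<^sup>2 \<le> e\<^sup>2 * G\<^sup>2"
    using assms by (intro mult_left_mono power_mono) auto
  finally have "(norm (v - u))\<^sup>2 \<le> (norm (x - u))\<^sup>2 - 2 * e * (g x \<bullet> (x - u)) + e\<^sup>2 * G\<^sup>2"
    by simp
  \<comment> \<open>The multiplier \<open>lam * s / 2\<close> is \<open>1 / (2 * e)\<close>, which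
    isolates the inner product.\<close>
  then have "lam * s / 2 * (2 * e * (g x \<bullet> (x - u)))
      \<le> lam * s / 2 * ((norm (x - u))\<^sup>2 - (norm (v - u))\<^sup>2 + e\<^sup>2 * G\<^sup>2)"
    using assms by (intro mult_left_mono) auto
  moreover have "lam * s / 2 * (2 * e * (g x \<bullet> (x - u))) = g x \<bullet> (x - u)"
    using assms by (simp add: e_def)
  moreover have "lam * s / 2 * (e\<^sup>2 * G\<^sup>2) = G\<^sup>2 / (2 * lam) * (1 / s)"
    using assms by (simp add: e_def power2_eq_square)
  ultimately have "g x \<bullet> (x - u)
      \<le> lam * s / 2 * ((norm (x - u))\<^sup>2 - (norm (v - u))\<^sup>2) + G\<^sup>2 / (2 * lam) * (1 / s)"
    by (simp only: distrib_left)
  \<comment> \<open>The quadratic term of strong convexity lowers the weight of the squared distance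
    from \<open>x\<close> to \<open>u\<close> from \<open>s\<close> to \<open>s - 1\<close>.\<close>
  moreover have "f u \<ge> f x + g x \<bullet> (u - x) + lam / 2 * (norm (u - x))\<^sup>2"
    using assms by (auto simp: strongly_convex_on_def)
  ultimately show ?thesis
    unfolding v_def e_def
    by (simp add: norm_minus_commute[of u x] inner_diff_right algebra_simps)
qed

lemma projected_gradient_regret:
  fixes X :: "'a::euclidean_space set"
  assumes "convex X" "closed X" "lam > 0" "c \<ge> 0" "u \<in> X"
    and "\<And>t. t \<in> {1..T} \<Longrightarrow> strongly_convex_on lam (f t) (g t) X"
    and "\<And>t. t \<in> {1..T} \<Longrightarrow> w t \<in> X"
    and "\<And>t. t \<in> {1..T} \<Longrightarrow> norm (g t (w t)) \<le> G"
    and "\<And>t. t \<in> {1..<T} \<Longrightarrow>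
      w (t + 1) = closest_point X (w t - (1 / (lam * (real t + c))) *\<^sub>R g t (w t))"
  shows "(\<Sum>t=1..T. f t (w t) - f t u)
    \<le> lam / 2 * c * (norm (w 1 - u))\<^sup>2 + G\<^sup>2 / (2 * lam) * (\<Sum>t=1..T. 1 / (real t + c))"
proof -
  define v where "v t = closest_point X (w t - (1 / (lam * (real t + c))) *\<^sub>R g t (w t))" for t
  \<comment> \<open>\<open>z n\<close> stands for the iterate of round n + 1: it is
    \<open>w (n + 1)\<close> for n < T, and the projected point at n = T, where nothing is assumed
    about \<open>w (T + 1)\<close>. The negative distance term must stay in the induction claim,
    since it cancels the positive one of the next round.\<close>
  define z where "z t = (if t = 0 then w 1 else v t)" for t
  have "(\<Sum>t=1..n. f t (w t) - f t u)
    \<le> lam / 2 * (c * (norm (w 1 - u))\<^sup>2 - (real n + c) * (norm (z n - u))\<^sup>2)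
      + G\<^sup>2 / (2 * lam) * (\<Sum>t=1..n. 1 / (real t + c))" if "n \<le> T" for n
    using that
  proof (induction n)
    case 0
    then show ?case by (simp add: z_def)
  next
    case (Suc n)
    have "z n = w (Suc n)"
      using assms(9)[of n] Suc.prems by (auto simp: z_def v_def)
    moreover have "f (Suc n) (w (Suc n)) - f (Suc n) u
        \<le> lam / 2 * ((real (Suc n) + c - 1) * (norm (w (Suc n) - u))\<^sup>2
          - (real (Suc n) + c) * (norm (z (Suc n) - u))\<^sup>2)
          + G\<^sup>2 / (2 * lam) * (1 / (real (Suc n) + c))"
      using projected_gradient_step_regret[OF assms(1,2,3) _ assms(6,7,5,8),
          of "real (Suc n) + c" "Suc n"]
        Suc.prems assms(4) by (auto simp: z_def v_def)
    ultimately show ?case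
      using Suc by (simp add: algebra_simps)
  qed
  from this[of T]
  have "(\<Sum>t=1..T. f t (w t) - f t u)
    \<le> lam / 2 * (c * (norm (w 1 - u))\<^sup>2 - (real T + c) * (norm (z T - u))\<^sup>2)
      + G\<^sup>2 / (2 * lam) * (\<Sum>t=1..T. 1 / (real t + c))" by simp
  also have "lam / 2 * (c * (norm (w 1 - u))\<^sup>2 - (real T + c) * (norm (z T - u))\<^sup>2)
      \<le> lam / 2 * (c * (norm (w 1 - u))\<^sup>2)"
    using assms by (intro mult_left_mono) auto
  finally show ?thesis by (simp add: mult.assoc)
qed

text \<open>This per-round bound is independent of the step sizes. It gives the D G T term, which is
  all that is claimed at S = 0.\<close>

lemma strongly_convex_on_diff_le:
  fixes X :: "'a::real_inner set"
  assumes "strongly_convex_on lam f g X" "lam \<ge> 0" "x \<in> X" "u \<in> X"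
    and "norm (g x) \<le> G" "norm (x - u) \<le> D"
  shows "f x - f u \<le> D * G"
proof -
  have "f u \<ge> f x + g x \<bullet> (u - x) + lam / 2 * (norm (u - x))\<^sup>2"
    using assms by (auto simp: strongly_convex_on_def)
  moreover have "lam / 2 * (norm (u - x))\<^sup>2 \<ge> 0" using assms by simp
  ultimately have "f x - f u \<le> g x \<bullet> (x - u)" by (simp add: inner_diff_right)
  also have "\<dots> \<le> norm (g x) * norm (x - u)" by (rule norm_cauchy_schwarz)
  also have "\<dots> \<le> G * D"
    using assms order_trans[OF norm_ge_zero assms(5)] by (intro mult_mono) auto
  finally show ?thesis by (simp add: mult.commute)
qed

text \<open>Below the threshold \<open>exp (lam / (2 * G) * S) - 1\<close> lies strictly between 0
  and T, so its quotient into T exceeds 1.\<close>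

lemma step_offset_nonneg:
  assumes "G > 0" "lam > 0" "S > 0"
  shows "step_offset G lam T S \<ge> 0"
proof (cases "S \<ge> budget_threshold G lam T")
  case False
  then have "lam / (2 * G) * S < ln (real T + 1)"
    using assms by (simp add: budget_threshold_def field_simps)
  then have "exp (lam / (2 * G) * S) < exp (ln (real T + 1))"
    by (simp only: exp_less_mono)
  then have "exp (lam / (2 * G) * S) - 1 \<le> real T" by simp
  moreover have "exp (lam / (2 * G) * S) - 1 > 0" using assms by simp
  ultimately show ?thesis using False by (simp add: step_offset_def)
qed (simp add: step_offset_def)

text \<open>Solving \<open>1 + T / (1 + c) = exp (lam / (2 * G) * S)\<close> for \<open>c\<close>
  gives the offset below the threshold. From the threshold on, \<open>c = 0\<close> and the ratio is
  T + 1; the minimum covers both cases.\<close>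

lemma ln_step_offset_ratio_eq:
  assumes "G > 0" "lam > 0" "S > 0" "T \<ge> 1"
  defines "c \<equiv> step_offset G lam T S"
  shows "2 * ln ((real T + 1 + c) / (1 + c)) = lam / G * min S (budget_threshold G lam T)"
proof (cases "S \<ge> budget_threshold G lam T")
  case True
  then show ?thesis using assms by (simp add: step_offset_def budget_threshold_def)
next
  case False
  define E where "E = exp (lam / (2 * G) * S)"
  have E: "E > 1" using assms by (simp add: E_def)
  have c: "1 + c = real T / (E - 1)"
    using False by (simp add: c_def step_offset_def E_def)
  have "(real T + 1 + c) / (1 + c) = (real T + real T / (E - 1)) / (real T / (E - 1))"
    using c by (simp add: add.assoc)
  also have "\<dots> = E"
    using E assms(4) by (simp add: field_simps)
  finally show ?thesis using False by (simp add: E_def)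
qed

theorem theorem5:
  fixes T :: nat and D G lam S :: real
    and f :: "nat \<Rightarrow> real ^ 'd \<Rightarrow> real"
    and g :: "nat \<Rightarrow> real ^ 'd \<Rightarrow> real ^ 'd"
    and w :: "nat \<Rightarrow> real ^ 'd"
  assumes "T \<ge> 1" and "D > 0" and "G > 0" and "lam > 0"
    and "\<And>t. t \<in> {1..T} \<Longrightarrow> strongly_convex_on lam (f t) (g t) (cball 0 (D / 2))"
    and "\<And>t x. t \<in> {1..T} \<Longrightarrow> x \<in> cball 0 (D / 2) \<Longrightarrow> norm (g t x) \<le> G"
    and "S \<ge> 0"
    and "S \<in> {budget_threshold G lam T..D * real T} \<or> S \<in> {0..<budget_threshold G lam T}"
    and "w 1 \<in> cball 0 (D / 2)"
    and "\<And>t. t \<in> {1..<T} \<Longrightarrow>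
           w (t + 1) = closest_point (cball 0 (D / 2))
                         (w t - step_size G lam T S t *\<^sub>R g t (w t))"
  shows "switching_cost T w \<le> S \<and>
    (S \<in> {budget_threshold G lam T..D * real T} \<longrightarrow>
       regret T (cball 0 (D / 2)) f w \<le> lam * D\<^sup>2 + 2 * G\<^sup>2 / lam * ln (real T + 1)) \<and>
    (S \<in> {0..<budget_threshold G lam T} \<longrightarrow>
       regret T (cball 0 (D / 2)) f w \<le>
         (if S = 0 then D * G * real T
          else min (lam * real T * D\<^sup>2 / (exp (lam / (2 * G) * S) - 1) + G * S)
                   (D * G * real T)))"
proof -
  define X :: "(real ^ 'd) set" where "X = cball 0 (D / 2)"
  define c where "c = step_offset G lam T S"
  have X: "convex X" "closed X" "compact X" "X \<noteq> {}"
    using assms(2) by (auto simp: X_def)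
  have diam: "norm (x - u) \<le> D" if "x \<in> X" "u \<in> X" for x u
    using norm_triangle_ineq4[of x u] that by (simp add: X_def)
  note sc = assms(5)[folded X_def]
  note step = assms(10)[folded X_def]
  have w: "w t \<in> X" if "t \<in> {1..T}" for t
  proof (cases "t = 1")
    case True
    then show ?thesis using assms(9) by (simp add: X_def)
  next
    case False
    then obtain s where "t = s + 1" "s \<in> {1..<T}"
      using \<open>t \<in> {1..T}\<close> by (cases t) auto
    then show ?thesis
      using step[of s] closest_point_in_set[OF X(2,4)] by simp
  qed
  have gw: "norm (g t (w t)) \<le> G" if "t \<in> {1..T}" for t
    using assms(6) w that by (simp add: X_def)
  obtain u where u: "u \<in> X" "(INF x\<in>X. \<Sum>t=1..T. f t x) = (\<Sum>t=1..T. f t u)"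
    using INF_loss_attained[of X T f g] X sc by (metis strongly_convex_on_def)
  have reg: "regret T X f w = (\<Sum>t=1..T. f t (w t) - f t u)"
    by (simp only: regret_def u(2) sum_subtractf)
  have trivial_bound: "regret T X f w \<le> D * G * real T"
  proof -
    have "regret T X f w \<le> (\<Sum>t=1..T. D * G)"
      unfolding reg using strongly_convex_on_diff_le[OF sc] w gw u diam assms(4)
      by (intro sum_mono) auto
    then show ?thesis by (simp add: mult.commute)
  qed
  have threshold_pos: "budget_threshold G lam T > 0"
    using assms(1,3,4) by (simp add: budget_threshold_def)
  show ?thesis
  proof (cases "S = 0")
    case True
    \<comment> \<open>All steps vanish, so the cost is 0. Positivity of the threshold places S = 0
      in the small-budget case, where the trivial regret bound suffices.\<close>
    have "switching_cost T w \<le> G * (\<Sum>t=1..T. step_size G lam T S t)"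
      using X w gw step assms(3) True
      by (intro switching_cost_projected_gradient_le[where g = g and X = X])
        (auto simp: step_size_def)
    then show ?thesis
      using True trivial_bound threshold_pos by (simp add: step_size_def X_def)
  next
    case False
    then have S: "S > 0" using assms(7) by simp
    have c: "c \<ge> 0" unfolding c_def using step_offset_nonneg assms(3,4) S by blast
    have eta: "step_size G lam T S = (\<lambda>t. 1 / (lam * (real t + c)))"
      using S by (auto simp: step_size_def c_def)
    have sum_le: "(\<Sum>t=1..T. 1 / (real t + c)) \<le> lam / G * min S (budget_threshold G lam T)"
      using sum_inverse_shift_le_ln[OF c, of T] ln_step_offset_ratio_eq[OF assms(3,4) S assms(1)]
      by (simp add: c_def)
    have "switching_cost T w \<le> G * (\<Sum>t=1..T. step_size G lam T S t)"
      using X w gw step assms(3,4) c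
      by (intro switching_cost_projected_gradient_le[where g = g and X = X]) (auto simp: eta)
    also have "\<dots> = G / lam * (\<Sum>t=1..T. 1 / (real t + c))"
      by (simp add: eta sum_distrib_left)
    also have "\<dots> \<le> G / lam * (lam / G * min S (budget_threshold G lam T))"
      using assms(3,4) by (intro mult_left_mono sum_le) auto
    also have "\<dots> \<le> S" using assms(3,4) by simp
    finally have cost: "switching_cost T w \<le> S" .
    have "regret T X f w
        \<le> lam / 2 * c * (norm (w 1 - u))\<^sup>2 + G\<^sup>2 / (2 * lam) * (\<Sum>t=1..T. 1 / (real t + c))"
      unfolding reg using X sc w gw step assms(4) c u
      by (intro projected_gradient_regret[where g = g and X = X]) (auto simp: eta)
    \<comment> \<open>Both \<open>w 1\<close> and the comparator lie in a ball of diameter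
      D.\<close>
    also have "\<dots> \<le> lam / 2 * c * D\<^sup>2
        + G\<^sup>2 / (2 * lam) * (lam / G * min S (budget_threshold G lam T))"
      using assms(1,4) c sum_le diam[OF w u(1)]
      by (intro add_mono mult_left_mono power_mono) auto
    also have "\<dots> = lam / 2 * c * D\<^sup>2 + G / 2 * min S (budget_threshold G lam T)"
      using assms(3,4) by (simp add: power2_eq_square)
    finally have main: "regret T X f w \<le> \<dots>" .
    have large: "regret T X f w \<le> lam * D\<^sup>2 + 2 * G\<^sup>2 / lam * ln (real T + 1)"
      if "S \<ge> budget_threshold G lam T"
    proof -
      \<comment> \<open>Here \<open>c = 0\<close> removes the distance term, leaving
        \<open>G^2 / lam * ln (T + 1)\<close>, which is half of the stated logarithmic term.\<close>
      have "regret T X f w \<le> G / 2 * budget_threshold G lam T"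
        using main that by (simp add: c_def step_offset_def)
      also have "\<dots> \<le> 2 * G * budget_threshold G lam T / 2"
        using assms(3) threshold_pos by simp
      also have "\<dots> = 2 * G\<^sup>2 / lam * ln (real T + 1)"
        by (simp add: budget_threshold_def power2_eq_square)
      also have "\<dots> \<le> lam * D\<^sup>2 + 2 * G\<^sup>2 / lam * ln (real T + 1)"
        using assms(4) by simp
      finally show ?thesis .
    qed
    have small: "regret T X f w \<le> lam * real T * D\<^sup>2 / (exp (lam / (2 * G) * S) - 1) + G * S"
      if "S < budget_threshold G lam T"
    proof -
      define q where "q = real T / (exp (lam / (2 * G) * S) - 1)"
      \<comment> \<open>Here \<open>c = q - 1\<close>, and \<open>c >= 0\<close> makes
        \<open>q\<close> positive. The factor 2 cancels the half in
        \<open>lam / 2 * c * D^2\<close>.\<close>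
      have q: "c \<le> 2 * q"
        using that c by (simp add: c_def step_offset_def q_def)
      have "lam / 2 * c * D\<^sup>2 \<le> lam / 2 * (2 * q) * D\<^sup>2"
        using q assms(4) by (intro mult_right_mono mult_left_mono) auto
      moreover have "G / 2 * min S (budget_threshold G lam T) \<le> G * S"
        using that assms(3) S by simp
      ultimately have "regret T X f w \<le> lam * q * D\<^sup>2 + G * S"
        using main by simp
      then show ?thesis by (simp add: q_def)
    qed
    show ?thesis
      using cost large small trivial_bound False unfolding X_def by simp
  qed
qed

end
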